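(* Consider the speed-aware network design problem $$(\mathrm{P})\qquad \min_{\boldsymbol{x},\boldsymbol{y},\boldsymbol{z}}\ \sum_{e\in\mathcal{E}}c_e y_e-\gamma\sum_{d\in\mathcal{D}}I_d(\boldsymbol{z}_d)$$ subject to $$\sum_{k\in\mathcal{K}}\sum_{p\in\mathcal{P}_{k\ni e}}v_k x_p\le V_e y_e\ \ \forall e\in\mathcal{E},\qquad \sum_{p\in\mathcal{P}_k}x_p=1\ \ \forall k\in\mathcal{K},\qquad z_{od}=\sum_{p\in\mathcal{P}_k}w_p x_p\ \ \forall k=(o,d)\in\mathcal{K},$$ $$x_p\in\{0,1\}\ \ \forall k\in\mathcal{K},\,p\in\mathcal{P}_k,\qquad y_e\in\mathbb{Z}_+\ \ \forall e\in\mathcal{E},\qquad z_{od}\in\{0,1\}\ \ \forall o\in\mathcal{O},\,d\in\mathcal{D},$$ and the mixed-integer linear program $$(\mathrm{M})\qquad \min_{\boldsymbol{x},\boldsymbol{y},\{\boldsymbol{z}_d,\boldsymbol{\alpha}_d\}_{d\in\mathcal{D}}}\ \sum_{e\in\mathcal{E}}c_e y_e-\gamma\sum_{d\in\mathcal{D}}\sum_{i=1}^{n_{\texttt{comb}}}\alpha_d^i\,I_d(\boldsymbol{z}_d^i)$$ subject to all the constraints of $(\mathrm{P})$ together with $$\sum_{i=1}^{n_{\texttt{comb}}}\alpha_d^i\,\boldsymbol{z}_d^i=\boldsymbol{z}_d,\qquad \sum_{i=1}^{n_{\texttt{comb}}}\alpha_d^i=1,\qquad \boldsymbol{\alpha}_d\in\mathbb{R}_+^{n_{\texttt{comb}}}\qquad\forall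 d\in\mathcal{D}.$$ Then $(\mathrm{M})$ is equivalent to $(\mathrm{P})$: the two problems have the same optimal value, and $(\boldsymbol{x},\boldsymbol{y},\boldsymbol{z})$ is an optimal solution of $(\mathrm{P})$ if and only if there exists $(\boldsymbol{\alpha}_d)_{d\in\mathcal{D}}$ such that $(\boldsymbol{x},\boldsymbol{y},\{\boldsymbol{z}_d,\boldsymbol{\alpha}_d\}_{d\in\mathcal{D}})$ is an optimal solution of $(\mathrm{M})$.
   Context: $\mathcal{G}=(\mathcal{V},\mathcal{E})$ is a finite directed graph with $\mathcal{V}=\mathcal{O}\cup\mathcal{D}\cup\mathcal{H}$: a set $\mathcal{O}$ of $n_O$ origins, a set $\mathcal{D}$ of destinations and a set $\mathcal{H}$ of other interim nodes (hubs). $\mathcal{K}$ is a finite set of commodities; each commodity $k=(o_k,d_k)$ has origin $o_k\in\mathcal{O}$, destination $d_k\in\mathcal{D}$ and volume $v_k\ge 0$. $\mathcal{P}_k$ is a given finite set of (active) paths for commodity $k$ (each path belongs to exactly one commodity), and $\mathcal{P}_{k\ni e}\subseteq\mathcal{P}_k$ is the subset of those paths that traverse link $e$. Each link $e$ has a truck cost $c_e$ and a truck capacity $V_e\in\mathbb{R}_+$; $y_e$ is the number of trucks opened on $e$. For each path $p$, $w_p=1$ if $p$ is short (total transit time below a given threshold) and $w_p=0$ otherwise. $\gamma>0$ is a given constant. For each $d\in\mathcal{D}$, $\boldsymbol{z}_d=(z_{od})_{o\in\mathcal{O}}$, and $\boldsymbol{z}=(\boldsymbol{z}_d)_{d\in\mathcal{D}}$.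 The vectors $\boldsymbol{z}_d^1,\dots,\boldsymbol{z}_d^{n_{\texttt{comb}}}$, with $n_{\texttt{comb}}=2^{n_O}$, are pairwise distinct and enumerate all of $\{0,1\}^{n_O}$. The coverage function $I_d:\{0,1\}^{n_O}\to\mathbb{R}$ has the form $$I_d(\boldsymbol{z}_d)=\sum_{s\subseteq\mathcal{O}_d}\beta_s\prod_{i\in s}z_{id}\prod_{j\in\mathcal{O}_d\setminus s}(1-z_{jd}),$$ where $\mathcal{O}_d\subseteq\mathcal{O}$ is the set of origins that form a commodity with $d$ and $\beta_s$ is a given number (the count of unique items stored at the set $s$ of origins). The optimal value of a minimization problem is the infimum of its objective over its feasible set (equal to $+\infty$ if infeasible). *)

theory Defs
  imports
    "HOL-Library.Extended_Real"
    "HOL-Library.FuncSet"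
    "HOL-Library.Disjoint_Sets"
    "Graph_Theory.Arc_Walk"
begin

text \<open>
  A commodity is an origin-destination pair and a path is the list of its links.
  The transit time is an arbitrary function of the path, so that waiting or handling
  times at the nodes may be part of it.
\<close>

record ('v, 'e) network =
  graph :: "('v, 'e) pre_digraph"
  origins :: "'v set"
  destinations :: "'v set"
  hubs :: "'v set"
  commodities :: "('v \<times> 'v) set"
  volume :: "'v \<times> 'v \<Rightarrow> real"
  active_paths :: "'v \<times> 'v \<Rightarrow> 'e list set"
  truck_cost :: "'e \<Rightarrow> real"
  truck_capacity :: "'e \<Rightarrow> real"
  transit_time :: "'e list \<Rightarrow> real"
  threshold :: real
  speed_weight :: real \<comment> \<open>the constant \<open>\<gamma>\<close>\<close>
  item_count :: "'v set \<Rightarrow> real" \<comment> \<open>the numbers \<open>\<beta>\<^sub>s\<close>\<close>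

locale network_design = fin_digraph "graph N" for N :: "('v, 'e) network" +
  assumes verts_eq: "verts (graph N) = origins N \<union> destinations N \<union> hubs N"
    and hubs_disjoint: "hubs N \<inter> (origins N \<union> destinations N) = {}"
    and commodities_subset: "commodities N \<subseteq> origins N \<times> destinations N"
    and volume_nonneg: "k \<in> commodities N \<Longrightarrow> 0 \<le> volume N k"
    and finite_active_paths: "k \<in> commodities N \<Longrightarrow> finite (active_paths N k)"
    and active_paths_awalk:
      "\<lbrakk>k \<in> commodities N; p \<in> active_paths N k\<rbrakk> \<Longrightarrow> awalk (fst k) p (snd k)"
    and active_paths_disjoint: "disjoint_family_on (active_paths N) (commodities N)"
    and truck_capacity_nonneg: "e \<in> arcs (graph N) \<Longrightarrow> 0 \<le> truck_capacity N e"
    and speed_weight_pos: "0 < speed_weight N"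

definition paths_through :: "('v, 'e) network \<Rightarrow> 'v \<times> 'v \<Rightarrow> 'e \<Rightarrow> 'e list set" where
  "paths_through N k e = {p \<in> active_paths N k. e \<in> set p}"

definition short :: "('v, 'e) network \<Rightarrow> 'e list \<Rightarrow> real" where
  "short N p = (if transit_time N p < threshold N then 1 else 0)"

definition origins_of :: "('v, 'e) network \<Rightarrow> 'v \<Rightarrow> 'v set" where
  "origins_of N d = {oo \<in> origins N. (oo, d) \<in> commodities N}"

definition coverage :: "('v, 'e) network \<Rightarrow> 'v \<Rightarrow> ('v \<Rightarrow> real) \<Rightarrow> real" where
  "coverage N d zd =
     (\<Sum>s\<in>Pow (origins_of N d).
        item_count N s * (\<Prod>i\<in>s. zd i) * (\<Prod>j\<in>origins_of N d - s. 1 - zd j))"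

definition n_comb :: "('v, 'e) network \<Rightarrow> nat" where
  "n_comb N = 2 ^ card (origins N)"

text \<open>
  Vectors are extensional functions on their index sets. The number \<open>z\<^sub>o\<^sub>d\<close> is written
  \<open>z d oo\<close>, so that \<open>z d\<close> is the vector \<open>z\<^sub>d\<close>; likewise \<open>\<alpha> d i\<close> is the \<open>i\<close>-th entry of \<open>\<alpha>\<^sub>d\<close>
  and \<open>Z d i\<close> is the \<open>i\<close>-th element of the enumeration of the binary vectors.
\<close>

type_synonym ('v, 'e) P_sol = "('e list \<Rightarrow> real) \<times> ('e \<Rightarrow> real) \<times> ('v \<Rightarrow> 'v \<Rightarrow> real)"

type_synonym ('v, 'e) M_sol =
  "('e list \<Rightarrow> real) \<times> ('e \<Rightarrow> real) \<times> ('v \<Rightarrow> 'v \<Rightarrow> real) \<times> ('v \<Rightarrow> nat \<Rightarrow> real)"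

definition enumerates_binary :: "('v, 'e) network \<Rightarrow> ('v \<Rightarrow> nat \<Rightarrow> 'v \<Rightarrow> real) \<Rightarrow> bool" where
  "enumerates_binary N Z \<longleftrightarrow>
     (\<forall>d\<in>destinations N. bij_betw (Z d) {1..n_comb N} (origins N \<rightarrow>\<^sub>E {0, 1}))"

fun P_feasible :: "('v, 'e) network \<Rightarrow> ('v, 'e) P_sol \<Rightarrow> bool" where
  "P_feasible N (x, y, z) \<longleftrightarrow>
     (\<forall>e\<in>arcs (graph N).
        (\<Sum>k\<in>commodities N. \<Sum>p\<in>paths_through N k e. volume N k * x p)
          \<le> truck_capacity N e * y e) \<and>
     (\<forall>k\<in>commodities N. (\<Sum>p\<in>active_paths N k. x p) = 1) \<and>
     (\<forall>(oo, d)\<in>commodities N. z d oo = (\<Sum>p\<in>active_paths N (oo, d). short N p * x p)) \<and>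
     x \<in> (\<Union>k\<in>commodities N. active_paths N k) \<rightarrow>\<^sub>E {0, 1} \<and>
     y \<in> arcs (graph N) \<rightarrow>\<^sub>E \<nat> \<and>
     z \<in> destinations N \<rightarrow>\<^sub>E (origins N \<rightarrow>\<^sub>E {0, 1})"

fun P_objective :: "('v, 'e) network \<Rightarrow> ('v, 'e) P_sol \<Rightarrow> real" where
  "P_objective N (x, y, z) =
     (\<Sum>e\<in>arcs (graph N). truck_cost N e * y e)
       - speed_weight N * (\<Sum>d\<in>destinations N. coverage N d (z d))"

fun M_feasible ::
  "('v, 'e) network \<Rightarrow> ('v \<Rightarrow> nat \<Rightarrow> 'v \<Rightarrow> real) \<Rightarrow> ('v, 'e) M_sol \<Rightarrow> bool" where
  "M_feasible N Z (x, y, z, \<alpha>) \<longleftrightarrow>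
     P_feasible N (x, y, z) \<and>
     (\<forall>d\<in>destinations N. \<forall>oo\<in>origins N. (\<Sum>i=1..n_comb N. \<alpha> d i * Z d i oo) = z d oo) \<and>
     (\<forall>d\<in>destinations N. (\<Sum>i=1..n_comb N. \<alpha> d i) = 1) \<and>
     \<alpha> \<in> destinations N \<rightarrow>\<^sub>E ({1..n_comb N} \<rightarrow>\<^sub>E {0..})"

fun M_objective ::
  "('v, 'e) network \<Rightarrow> ('v \<Rightarrow> nat \<Rightarrow> 'v \<Rightarrow> real) \<Rightarrow> ('v, 'e) M_sol \<Rightarrow> real" where
  "M_objective N Z (x, y, z, \<alpha>) =
     (\<Sum>e\<in>arcs (graph N). truck_cost N e * y e)
       - speed_weight N *
         (\<Sum>d\<in>destinations N. \<Sum>i=1..n_comb N. \<alpha> d i * coverage N d (Z d i))"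

definition optimal_value :: "('a \<Rightarrow> real) \<Rightarrow> ('a \<Rightarrow> bool) \<Rightarrow> ereal" where
  "optimal_value f feasible = (INF s\<in>Collect feasible. ereal (f s))"

end

theory Submission
  imports Defs
begin

text \<open>
  The feasible vectors \<open>z\<^sub>d\<close> are vertices of the unit cube, and a vertex is an extreme point:
  the only convex combination of the binary vectors \<open>z\<^sub>d\<^sup>i\<close> that yields it puts all its weight on
  the vector itself (\<open>convex_weight_at_vertex\<close>, \<open>convex_sum_at_vertex\<close>). So in a feasible point of
  (M) the linearised term \<open>\<Sum>i. \<alpha>\<^sub>d\<^sup>i I\<^sub>d(z\<^sub>d\<^sup>i)\<close> is \<open>I\<^sub>d(z\<^sub>d)\<close>, whatever the function \<open>I\<^sub>d\<close> is, and
  the objectives of (M) and (P) agree (\<open>M_objective_eq\<close>). Conversely, since the enumeration is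
  exhaustive, a feasible point of (P) extends to one of (M) by taking for \<open>\<alpha>\<^sub>d\<close> the unit vector at
  the index of \<open>z\<^sub>d\<close> (\<open>P_feasible_lift\<close>). Forgetting \<open>\<alpha>\<close> is therefore an objective-preserving
  surjection from the feasible points of (M) onto those of (P), which makes the two problems
  equivalent (\<open>optimal_value_projection\<close>, \<open>is_arg_min_projection\<close>).
\<close>

lemma optimal_value_projection:
  assumes "\<And>s. Q s \<Longrightarrow> P (h s)" and "\<And>s. Q s \<Longrightarrow> g s = f (h s)"
    and "\<And>t. P t \<Longrightarrow> \<exists>s. Q s \<and> h s = t"
  shows "optimal_value g Q = optimal_value f P"
proof -
  have "(\<lambda>s. ereal (g s)) ` Collect Q = (\<lambda>t. ereal (f t)) ` h ` Collect Q"
    unfolding image_image using assms(2) by (intro image_cong) auto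
  moreover have "h ` Collect Q = Collect P"
    using assms(1,3) by (force simp: image_iff)
  ultimately show ?thesis
    unfolding optimal_value_def by simp
qed

lemma is_arg_min_projection:
  assumes "\<And>s. Q s \<Longrightarrow> P (h s)" and "\<And>s. Q s \<Longrightarrow> g s = f (h s)"
    and "\<And>t. P t \<Longrightarrow> \<exists>s. Q s \<and> h s = t"
  shows "is_arg_min f P t \<longleftrightarrow> (\<exists>s. h s = t \<and> is_arg_min g Q s)"
  unfolding is_arg_min_def using assms by metis

text \<open>
  In a coordinate where the vertex is \<open>0\<close> all the averaged entries lie above it, and where it is
  \<open>1\<close> all lie below it. The deviations thus have one sign, and their weighted sum is zero.
\<close>

lemma convex_weight_at_vertex:
  fixes a u :: "'i \<Rightarrow> real"
  assumes "finite I" and "\<And>i. i \<in> I \<Longrightarrow> 0 \<le> a i" and "sum a I = 1"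
    and "\<And>i. i \<in> I \<Longrightarrow> u i \<in> {0, 1}" and "c \<in> {0, 1}"
    and "(\<Sum>i\<in>I. a i * u i) = c"
    and "i \<in> I" and "a i \<noteq> 0"
  shows "u i = c"
proof -
  \<comment> \<open>\<open>1 - 2 * c\<close> is the common sign of the deviations: \<open>1\<close> for \<open>c = 0\<close>, \<open>-1\<close> for \<open>c = 1\<close>\<close>
  have dev: "\<bar>u j - c\<bar> = (1 - 2 * c) * (u j - c)" if "j \<in> I" for j
    using assms(4)[OF that] assms(5) by auto
  have "(\<Sum>j\<in>I. a j * \<bar>u j - c\<bar>) = (\<Sum>j\<in>I. (1 - 2 * c) * (a j * u j - c * a j))"
    by (intro sum.cong) (auto simp: dev algebra_simps)
  also have "\<dots> = (1 - 2 * c) * ((\<Sum>j\<in>I. a j * u j) - c * sum a I)"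
    by (simp add: sum_distrib_left sum_subtractf right_diff_distrib)
  also have "\<dots> = 0"
    using assms(3,6) by simp
  finally have "\<forall>j\<in>I. a j * \<bar>u j - c\<bar> = 0"
    using assms(1,2) by (subst (asm) sum_nonneg_eq_0_iff) auto
  then show ?thesis
    using assms(7,8) by auto
qed

lemma convex_sum_at_vertex:
  fixes a :: "'i \<Rightarrow> real" and W :: "'i \<Rightarrow> 'o \<Rightarrow> real" and F :: "('o \<Rightarrow> real) \<Rightarrow> real"
  assumes "finite I" and "\<And>i. i \<in> I \<Longrightarrow> 0 \<le> a i" and "sum a I = 1"
    and W: "\<And>i. i \<in> I \<Longrightarrow> W i \<in> A \<rightarrow>\<^sub>E {0, 1}" and w: "w \<in> A \<rightarrow>\<^sub>E {0, 1}"
    and comb: "\<And>j. j \<in> A \<Longrightarrow> (\<Sum>i\<in>I. a i * W i j) = w j"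
  shows "(\<Sum>i\<in>I. a i * F (W i)) = F w"
proof -
  have "W i = w" if "i \<in> I" "a i \<noteq> 0" for i
  proof (rule PiE_ext[OF W[OF that(1)] w])
    fix j assume "j \<in> A"
    then show "W i j = w j"
      using convex_weight_at_vertex[of I a "\<lambda>i. W i j" "w j" i]
        assms(1-3) PiE_mem[OF W] PiE_mem[OF w] comb that by auto
  qed
  then have "(\<Sum>i\<in>I. a i * F (W i)) = (\<Sum>i\<in>I. a i * F w)"
    by (intro sum.cong refl) fastforce
  then show ?thesis
    using assms(3) by (simp flip: sum_distrib_right)
qed

lemma M_objective_eq:
  assumes "enumerates_binary N Z" and "M_feasible N Z (x, y, z, \<alpha>)"
  shows "M_objective N Z (x, y, z, \<alpha>) = P_objective N (x, y, z)"
proof -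
  have "(\<Sum>i=1..n_comb N. \<alpha> d i * coverage N d (Z d i)) = coverage N d (z d)"
    if d: "d \<in> destinations N" for d
  proof (rule convex_sum_at_vertex[where A = "origins N" and W = "Z d"])
    show "Z d i \<in> origins N \<rightarrow>\<^sub>E {0, 1}" if "i \<in> {1..n_comb N}" for i
      using assms(1) d that unfolding enumerates_binary_def by (blast dest: bij_betw_apply)
    have "\<alpha> d \<in> {1..n_comb N} \<rightarrow>\<^sub>E {0..}"
      using assms(2) d by (auto dest: PiE_mem)
    then show "0 \<le> \<alpha> d i" if "i \<in> {1..n_comb N}" for i
      using PiE_mem that by fastforce
    show "z d \<in> origins N \<rightarrow>\<^sub>E {0, 1}"
      using assms(2) d by (auto dest: PiE_mem)
  qed (use assms(2) d in auto)
  then show ?thesis by simp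
qed

lemma P_feasible_lift:
  fixes N :: "('v, 'e) network"
  assumes "enumerates_binary N Z" and feas: "P_feasible N (x, y, z)"
  shows "\<exists>\<alpha>. M_feasible N Z (x, y, z, \<alpha>)"
proof -
  let ?D = "destinations N" and ?I = "{1..n_comb N}"
  have "\<exists>i\<in>?I. Z d i = z d" if "d \<in> ?D" for d
  proof -
    have "z d \<in> origins N \<rightarrow>\<^sub>E {0, 1}"
      using feas that by (auto dest: PiE_mem)
    then show ?thesis
      using assms(1) that unfolding enumerates_binary_def bij_betw_def by (metis imageE)
  qed
  then obtain m where m: "\<And>d. d \<in> ?D \<Longrightarrow> m d \<in> ?I \<and> Z d (m d) = z d"
    by metis
  define \<alpha> :: "'v \<Rightarrow> nat \<Rightarrow> real"
    where "\<alpha> = (\<lambda>d\<in>?D. \<lambda>i\<in>?I. if i = m d then 1 else 0)"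
  have pick: "(\<Sum>i\<in>?I. \<alpha> d i * u i) = u (m d)" if "d \<in> ?D" for d u
  proof -
    have "(\<Sum>i\<in>?I. \<alpha> d i * u i) = (\<Sum>i\<in>?I. if i = m d then u i else 0)"
      using that by (intro sum.cong) (auto simp: \<alpha>_def)
    then show ?thesis
      using m[OF that] by simp
  qed
  have "M_feasible N Z (x, y, z, \<alpha>)"
    unfolding M_feasible.simps
  proof (intro conjI ballI)
    show "(\<Sum>i\<in>?I. \<alpha> d i * Z d i oo) = z d oo" if "d \<in> ?D" for d oo
      using pick[OF that] m[OF that] by simp
    show "(\<Sum>i\<in>?I. \<alpha> d i) = 1" if "d \<in> ?D" for d
      using pick[OF that, of "\<lambda>_. 1"] by simp
    show "\<alpha> \<in> ?D \<rightarrow>\<^sub>E (?I \<rightarrow>\<^sub>E {0..})"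
      by (auto simp: \<alpha>_def)
  qed (rule feas)
  then show ?thesis by blast
qed

theorem mainTheorem2:
  fixes N :: "('v, 'e) network"
    and Z :: "'v \<Rightarrow> nat \<Rightarrow> 'v \<Rightarrow> real"
  assumes "network_design N"
    and "enumerates_binary N Z"
  shows "optimal_value (M_objective N Z) (M_feasible N Z)
           = optimal_value (P_objective N) (P_feasible N) \<and>
         (\<forall>x y z. is_arg_min (P_objective N) (P_feasible N) (x, y, z) \<longleftrightarrow>
            (\<exists>\<alpha>. is_arg_min (M_objective N Z) (M_feasible N Z) (x, y, z, \<alpha>)))"
proof -
  define h :: "('v, 'e) M_sol \<Rightarrow> ('v, 'e) P_sol" where "h = (\<lambda>(x, y, z, \<alpha>). (x, y, z))"
  have h: "h (x, y, z, \<alpha>) = (x, y, z)" for x y z \<alpha>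
    by (simp add: h_def)
  have feas: "P_feasible N (h s)" if "M_feasible N Z s" for s
    using that by (cases s) (auto simp only: h M_feasible.simps)
  have obj: "M_objective N Z s = P_objective N (h s)" if "M_feasible N Z s" for s
    using that M_objective_eq[OF assms(2)] by (cases s) (auto simp only: h)
  have lift: "\<exists>s. M_feasible N Z s \<and> h s = t" if "P_feasible N t" for t
    using that P_feasible_lift[OF assms(2)] h by (cases t) metis
  have "is_arg_min (P_objective N) (P_feasible N) (x, y, z) \<longleftrightarrow>
      (\<exists>\<alpha>. is_arg_min (M_objective N Z) (M_feasible N Z) (x, y, z, \<alpha>))" for x y z
    using is_arg_min_projection[of "M_feasible N Z" "P_feasible N" h "M_objective N Z"
        "P_objective N" "(x, y, z)", OF feas obj lift]
    by (simp add: h_def split_paired_Ex)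
  then show ?thesis
    using optimal_value_projection[of "M_feasible N Z" "P_feasible N" h "M_objective N Z"
        "P_objective N", OF feas obj lift] by blast
qed

end
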